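(* There is a constant $c>0$ such that for all sufficiently large $n$ the following holds: if $\widetilde K_n$ is a convex straight-line drawing of $K_n$, then $\overline\tau(\widetilde K_n)\ge c\log\log n$, i.e. under every edge-ordering of $\widetilde K_n$ there is a non-crossing monotone complete binary tree in $\widetilde K_n$ with at least $c\log\log n$ vertices.
   Context: A geometric graph is a graph whose vertices are points in the plane in general position and whose edges are straight line segments; a straight-line drawing of $G$ is a geometric graph isomorphic to $G$; it is convex if its vertices are in convex position. An edge-ordering is a total order on the edges. In an edge-ordered graph, a path $v_1v_2\ldots v_k$ is increasing if $(v_iv_{i+1}) > (v_{i+1}v_{i+2})$ for all $i=1,\ldots,k-2$ and decreasing if $(v_iv_{i+1}) < (v_{i+1}v_{i+2})$ for all $i$. All binary trees are complete and rooted (every internal vertex has exactly two children and all leaves are at the same depth); the size of a tree is its number of vertices. A rooted tree (as a subgraph) is increasing (resp. decreasing) if every path from the root to a leaf is increasing (resp. decreasing), and monotone if it is increasing or decreasing. A tree in a geometric graph is non-crossing if no two of its edges cross. $\overline\tau(\widetilde G)$ is the minimum over all edge-orderings of $\widetilde G$ of the maximum size of a non-crossing monotone binary tree in $\widetilde G$. *)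

theory Defs
  imports "HOL-Analysis.Analysis"
begin

section \<open>Graphs, paths and complete binary trees\<close>

type_synonym 'v graph = "'v set \<times> 'v set set"

abbreviation verts :: "'v graph \<Rightarrow> 'v set" where "verts \<equiv> fst"
abbreviation edges :: "'v graph \<Rightarrow> 'v set set" where "edges \<equiv> snd"

definition simple_graph :: "'v graph \<Rightarrow> bool" where
  "simple_graph G \<longleftrightarrow> (\<forall>e\<in>edges G. e \<subseteq> verts G \<and> card e = 2)"

definition subgraph :: "'v graph \<Rightarrow> 'v graph \<Rightarrow> bool" where
  "subgraph H G \<longleftrightarrow> simple_graph H \<and> verts H \<subseteq> verts G \<and> edges H \<subseteq> edges G"

definition graph_isomorphic :: "'u graph \<Rightarrow> 'v graph \<Rightarrow> bool" where
  "graph_isomorphic G H \<longleftrightarrow>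
     (\<exists>f. bij_betw f (verts G) (verts H) \<and> edges H = (\<lambda>e. f ` e) ` edges G)"

definition complete_graph :: "nat \<Rightarrow> nat graph" where
  "complete_graph n = ({..<n}, {e. e \<subseteq> {..<n} \<and> card e = 2})"

definition graph_path :: "'v graph \<Rightarrow> 'v list \<Rightarrow> bool" where
  "graph_path G p \<longleftrightarrow> p \<noteq> [] \<and> distinct p \<and> set p \<subseteq> verts G \<and>
     successively (\<lambda>u v. {u, v} \<in> edges G) p"

definition graph_connected :: "'v graph \<Rightarrow> bool" where
  "graph_connected G \<longleftrightarrow> verts G \<noteq> {} \<and>
     (\<forall>u\<in>verts G. \<forall>v\<in>verts G. \<exists>p. graph_path G p \<and> hd p = u \<and> last p = v)"

definition graph_acyclic :: "'v graph \<Rightarrow> bool" where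
  "graph_acyclic G \<longleftrightarrow>
     \<not> (\<exists>p. graph_path G p \<and> length p \<ge> 3 \<and> {last p, hd p} \<in> edges G)"

definition is_tree :: "'v graph \<Rightarrow> bool" where
  "is_tree T \<longleftrightarrow>
     simple_graph T \<and> finite (verts T) \<and> graph_connected T \<and> graph_acyclic T"

definition path_from :: "'v graph \<Rightarrow> 'v \<Rightarrow> 'v list \<Rightarrow> bool" where
  "path_from T \<rho> p \<longleftrightarrow> graph_path T p \<and> hd p = \<rho>"

text \<open>A vertex \<open>w\<close> is a child of \<open>v\<close> in the tree \<open>T\<close> rooted at \<open>\<rho>\<close> iff \<open>v\<close> is the
  last vertex before \<open>w\<close> on the path from \<open>\<rho>\<close> to \<open>w\<close>.\<close>

definition children :: "'v graph \<Rightarrow> 'v \<Rightarrow> 'v \<Rightarrow> 'v set" where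
  "children T \<rho> v = {w. \<exists>p. path_from T \<rho> (p @ [v, w])}"

definition is_leaf :: "'v graph \<Rightarrow> 'v \<Rightarrow> 'v \<Rightarrow> bool" where
  "is_leaf T \<rho> v \<longleftrightarrow> v \<in> verts T \<and> children T \<rho> v = {}"

definition root_leaf_path :: "'v graph \<Rightarrow> 'v \<Rightarrow> 'v list \<Rightarrow> bool" where
  "root_leaf_path T \<rho> p \<longleftrightarrow> path_from T \<rho> p \<and> is_leaf T \<rho> (last p)"

definition complete_binary_tree :: "'v graph \<Rightarrow> 'v \<Rightarrow> bool" where
  "complete_binary_tree T \<rho> \<longleftrightarrow> is_tree T \<and> \<rho> \<in> verts T \<and>
     (\<forall>v\<in>verts T. \<not> is_leaf T \<rho> v \<longrightarrow> card (children T \<rho> v) = 2) \<and>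
     (\<exists>d. \<forall>p. root_leaf_path T \<rho> p \<longrightarrow> length p = Suc d)"


section \<open>Edge-orderings and monotone trees\<close>

definition edge_ordering :: "'v graph \<Rightarrow> ('v set \<times> 'v set) set \<Rightarrow> bool" where
  "edge_ordering G r \<longleftrightarrow> linear_order_on (edges G) r"

definition edge_less :: "('v set \<times> 'v set) set \<Rightarrow> 'v set \<Rightarrow> 'v set \<Rightarrow> bool" where
  "edge_less r e f \<longleftrightarrow> (e, f) \<in> r \<and> e \<noteq> f"

text \<open>By convention, the edges get smaller along an increasing path, so that it is
  increasing when read towards its first vertex.\<close>

definition increasing_path :: "('v set \<times> 'v set) set \<Rightarrow> 'v list \<Rightarrow> bool" where
  "increasing_path r p \<longleftrightarrow> (\<forall>i. i + 2 < length p \<longrightarrow>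
     edge_less r {p ! (i + 1), p ! (i + 2)} {p ! i, p ! (i + 1)})"

definition decreasing_path :: "('v set \<times> 'v set) set \<Rightarrow> 'v list \<Rightarrow> bool" where
  "decreasing_path r p \<longleftrightarrow> (\<forall>i. i + 2 < length p \<longrightarrow>
     edge_less r {p ! i, p ! (i + 1)} {p ! (i + 1), p ! (i + 2)})"

definition increasing_tree ::
  "('v set \<times> 'v set) set \<Rightarrow> 'v graph \<Rightarrow> 'v \<Rightarrow> bool" where
  "increasing_tree r T \<rho> \<longleftrightarrow> (\<forall>p. root_leaf_path T \<rho> p \<longrightarrow> increasing_path r p)"

definition decreasing_tree ::
  "('v set \<times> 'v set) set \<Rightarrow> 'v graph \<Rightarrow> 'v \<Rightarrow> bool" where
  "decreasing_tree r T \<rho> \<longleftrightarrow> (\<forall>p. root_leaf_path T \<rho> p \<longrightarrow> decreasing_path r p)"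

definition monotone_tree ::
  "('v set \<times> 'v set) set \<Rightarrow> 'v graph \<Rightarrow> 'v \<Rightarrow> bool" where
  "monotone_tree r T \<rho> \<longleftrightarrow> increasing_tree r T \<rho> \<or> decreasing_tree r T \<rho>"


section \<open>Geometric graphs\<close>

type_synonym point = "real^2"

definition general_position :: "point set \<Rightarrow> bool" where
  "general_position S \<longleftrightarrow> (\<forall>A\<subseteq>S. card A = 3 \<longrightarrow> \<not> collinear A)"

definition convex_position :: "point set \<Rightarrow> bool" where
  "convex_position S \<longleftrightarrow> (\<forall>p\<in>S. p \<notin> convex hull (S - {p}))"

text \<open>The straight line segments are determined by the edges as 2-element vertex sets.\<close>

definition geometric_graph :: "point graph \<Rightarrow> bool" where
  "geometric_graph D \<longleftrightarrow>
     simple_graph D \<and> finite (verts D) \<and> general_position (verts D)"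

definition straight_line_drawing :: "point graph \<Rightarrow> 'v graph \<Rightarrow> bool" where
  "straight_line_drawing D G \<longleftrightarrow> geometric_graph D \<and> graph_isomorphic D G"

definition convex_drawing :: "point graph \<Rightarrow> 'v graph \<Rightarrow> bool" where
  "convex_drawing D G \<longleftrightarrow> straight_line_drawing D G \<and> convex_position (verts D)"

text \<open>In general position, distinct edges with a common endpoint have no further common
  point, so two edges cross iff their relative interiors meet.\<close>

definition edges_cross :: "point set \<Rightarrow> point set \<Rightarrow> bool" where
  "edges_cross e f \<longleftrightarrow> e \<noteq> f \<and>
     (\<exists>a b c d. e = {a, b} \<and> f = {c, d} \<and> open_segment a b \<inter> open_segment c d \<noteq> {})"

definition non_crossing :: "point graph \<Rightarrow> bool" where
  "non_crossing D \<longleftrightarrow> (\<forall>e\<in>edges D. \<forall>f\<in>edges D. \<not> edges_cross e f)"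

definition noncrossing_monotone_binary_tree ::
  "point graph \<Rightarrow> (point set \<times> point set) set \<Rightarrow> point graph \<Rightarrow> point \<Rightarrow> bool" where
  "noncrossing_monotone_binary_tree D r T \<rho> \<longleftrightarrow>
     subgraph T D \<and> complete_binary_tree T \<rho> \<and> non_crossing T \<and> monotone_tree r T \<rho>"

definition max_tree_size :: "point graph \<Rightarrow> (point set \<times> point set) set \<Rightarrow> nat" where
  "max_tree_size D r =
     Max {card (verts T) |T. \<exists>\<rho>. noncrossing_monotone_binary_tree D r T \<rho>}"

definition tau_bar :: "point graph \<Rightarrow> nat" where
  "tau_bar D = Min {max_tree_size D r |r. edge_ordering D r}"

end

theory Submission
  imports Defs "HOL-Library.List_Lexorder" "HOL-Library.Sublist"
begin

text \<open>
  Number the vertices arbitrarily and colour each triple \<open>u < v < w\<close> with two bits: whether the edge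
  \<open>uv\<close> precedes \<open>vw\<close>, and the orientation of the triangle \<open>uvw\<close>. The Erdos-Rado argument gives
  about \<open>log log n\<close> vertices whose triples all have the same colour. Constant orientation means that
  these vertices lie on a convex curve in the order of their numbers, so two edges cross only if
  they interleave. Placing a complete binary tree on them in preorder produces no interleaving
  edges, and every path away from the root has increasing numbers, hence is monotone in the edge
  ordering, always in the same direction.
\<close>

section \<open>Ramsey's theorem for triples\<close>

text \<open>Pigeonhole on whole rows: each \<open>w\<close> determines the function sending
  \<open>u\<close> in \<open>S\<close> to \<open>c u w\<close>, and there are only
  \<open>CARD('c) ^ card S\<close> such functions. \<open>W'\<close> is a largest-enough
  fibre.\<close>

lemma large_common_class:
  fixes c :: "'a \<Rightarrow> 'b \<Rightarrow> 'c::finite"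
  assumes "finite S" "finite W"
  obtains W' where "W' \<subseteq> W" "card W \<le> card W' * CARD('c) ^ card S"
    "\<And>u w w'. \<lbrakk>u \<in> S; w \<in> W'; w' \<in> W'\<rbrakk> \<Longrightarrow> c u w = c u w'"
proof -
  define f where "f w = restrict (\<lambda>u. c u w) S" for w
  have "f \<in> W \<rightarrow> (S \<rightarrow>\<^sub>E UNIV)" by (auto simp: f_def)
  moreover have "finite (S \<rightarrow>\<^sub>E (UNIV :: 'c set))" using assms by (auto intro: finite_PiE)
  moreover have "(S \<rightarrow>\<^sub>E (UNIV :: 'c set)) \<noteq> {}" by (auto simp: PiE_eq_empty_iff)
  ultimately obtain g where g: "card (f -` {g} \<inter> W) * card (S \<rightarrow>\<^sub>E (UNIV :: 'c set)) \<ge> card W"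
    using pigeonhole_card[of f W "S \<rightarrow>\<^sub>E UNIV"] assms by blast
  show thesis
  proof (rule that[of "f -` {g} \<inter> W"])
    show "card W \<le> card (f -` {g} \<inter> W) * CARD('c) ^ card S"
      using g assms by (simp add: card_funcsetE)
    fix u w w' assume "u \<in> S" "w \<in> f -` {g} \<inter> W" "w' \<in> f -` {g} \<inter> W"
    then have "f w u = f w' u" by simp
    then show "c u w = c u w'" using \<open>u \<in> S\<close> by (simp add: f_def)
  qed simp
qed

text \<open>Greedy selection: take the least element \<open>x\<close>, keep only a majority class of
  the others by their colour with \<open>x\<close>, and repeat. The colour of a selected pair then
  depends on its smaller element alone, at the cost of a factor \<open>CARD('c)\<close> per selected
  element.\<close>

lemma end_homogeneous_pairs:
  fixes c :: "'a::linorder \<Rightarrow> 'a \<Rightarrow> 'c::finite"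
  assumes "finite W" "CARD('c) \<ge> 2" "card W \<ge> CARD('c) ^ t"
  shows "\<exists>S\<subseteq>W. card S = t \<and>
    (\<forall>u\<in>S. \<forall>v\<in>S. \<forall>v'\<in>S. u < v \<longrightarrow> u < v' \<longrightarrow> c u v = c u v')"
  using assms(1,3)
proof (induction t arbitrary: W)
  case 0
  then show ?case by (intro exI[of _ "{}"]) auto
next
  case (Suc t)
  let ?q = "CARD('c)"
  define x where "x = Min W"
  have "W \<noteq> {}" using Suc.prems assms(2) by auto
  then have x: "x \<in> W" "\<And>w. w \<in> W - {x} \<Longrightarrow> x < w"
    using Suc.prems(1) by (auto simp: x_def less_le)
  obtain W' where W': "W' \<subseteq> W - {x}" "card (W - {x}) \<le> card W' * ?q ^ card {x}"
    "\<And>u w w'. \<lbrakk>u \<in> {x}; w \<in> W'; w' \<in> W'\<rbrakk> \<Longrightarrow> c u w = c u w'"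
    using large_common_class[of "{x}" "W - {x}" c] Suc.prems(1) by (metis finite.emptyI finite.insertI finite_Diff)
  have fin: "finite W'" using W'(1) Suc.prems(1) finite_subset by blast
  \<comment> \<open>Removing \<open>x\<close> costs one element besides the division by
    \<open>?q\<close>. Integrality absorbs it: a smaller \<open>W'\<close> would give
    \<open>card W + ?q - 1 \<le> ?q ^ Suc t\<close>, too little for
    \<open>?q \<ge> 2\<close>.\<close>
  have "?q ^ t \<le> card W'"
  proof (rule ccontr)
    assume "\<not> ?thesis"
    then have "Suc (card W') * ?q \<le> ?q ^ t * ?q" by (intro mult_right_mono) auto
    moreover have "card W = Suc (card (W - {x}))" using card_Suc_Diff1[OF Suc.prems(1) x(1)] by simp
    ultimately show False using W'(2) Suc.prems(2) assms(2) by (simp add: algebra_simps)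
  qed
  from Suc.IH[OF fin this] obtain S where S: "S \<subseteq> W'" "card S = t"
    "\<forall>u\<in>S. \<forall>v\<in>S. \<forall>v'\<in>S. u < v \<longrightarrow> u < v' \<longrightarrow> c u v = c u v'" by blast
  have lt: "\<And>w. w \<in> S \<Longrightarrow> x < w" using S(1) W'(1) x(2) by blast
  have "card (insert x S) = Suc t"
    using S(2) lt finite_subset[OF S(1) fin] by (subst card_insert_disjoint) fastforce+
  moreover have "insert x S \<subseteq> W" using S(1) W'(1) x(1) by blast
  moreover have "\<forall>u\<in>insert x S. \<forall>v\<in>insert x S. \<forall>v'\<in>insert x S.
      u < v \<longrightarrow> u < v' \<longrightarrow> c u v = c u v'"
  proof (intro ballI impI)
    fix u v v'
    assume *: "u \<in> insert x S" "v \<in> insert x S" "v' \<in> insert x S" "u < v" "u < v'"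
    show "c u v = c u v'"
    proof (cases "u = x")
      case True
      then have "v \<in> W'" "v' \<in> W'" using * S(1) by auto
      then show ?thesis using W'(3) True by blast
    next
      case False
      then have "u \<in> S" "v \<in> S" "v' \<in> S" using * lt[of u] by auto
      then show ?thesis using S(3) * by blast
    qed
  qed
  ultimately show ?case by blast
qed

text \<open>In an end-homogeneous set of \<open>CARD('c) * m\<close> elements every element has its
  own colour towards the larger ones, so some colour belongs to at least \<open>m\<close> of
  them.\<close>

lemma ramsey_pairs:
  fixes c :: "'a::linorder \<Rightarrow> 'a \<Rightarrow> 'c::finite"
  assumes "finite W" "CARD('c) \<ge> 2" "card W \<ge> CARD('c) ^ (CARD('c) * m)"
  obtains S col where "S \<subseteq> W" "card S \<ge> m" "\<And>u v. \<lbrakk>u \<in> S; v \<in> S; u < v\<rbrakk> \<Longrightarrow> c u v = col"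
proof -
  let ?q = "CARD('c)"
  obtain R where R: "R \<subseteq> W" "card R = ?q * m"
    "\<forall>u\<in>R. \<forall>v\<in>R. \<forall>v'\<in>R. u < v \<longrightarrow> u < v' \<longrightarrow> c u v = c u v'"
    using end_homogeneous_pairs[OF assms] by blast
  \<comment> \<open>The greatest element of \<open>R\<close> has no larger partner and gets an
    arbitrary colour from \<open>SOME\<close>. This is harmless, since it is never the smaller
    element of a pair.\<close>
  define f where "f u = c u (SOME v. v \<in> R \<and> u < v)" for u
  have f: "c u v = f u" if "u \<in> R" "v \<in> R" "u < v" for u v
  proof -
    have "(SOME v. v \<in> R \<and> u < v) \<in> R \<and> u < (SOME v. v \<in> R \<and> u < v)"
      using that by (intro someI) auto
    then show ?thesis unfolding f_def using that R(3) by blast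
  qed
  have "finite R" using R(1) assms(1) finite_subset by blast
  then obtain col where col: "card (f -` {col} \<inter> R) * card (UNIV :: 'c set) \<ge> card R"
    using pigeonhole_card[of f R UNIV] by auto
  show thesis
  proof (rule that[of "f -` {col} \<inter> R" col])
    show "card (f -` {col} \<inter> R) \<ge> m" using col R(2) assms(2) by (simp add: mult.commute)
  qed (use R(1) f in auto)
qed

text \<open>The Erdos-Rado step. \<open>S\<close> holds the elements selected so far and
  \<open>W\<close> the candidates above them; the colour of a triple starting with two elements of
  \<open>S\<close> no longer depends on its third element. Selecting \<open>x = Min W\<close> means
  splitting the rest by the colours of \<open>u, x, w\<close> for all \<open>u\<close> in
  \<open>S\<close>. Each of the \<open>j\<close> remaining selections thus divides the reservoir by
  at most \<open>CARD('c) ^ k\<close>, whence the exponent \<open>k * j\<close>.\<close>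

lemma end_homogeneous_triples_extend:
  fixes c :: "'a::linorder \<Rightarrow> 'a \<Rightarrow> 'a \<Rightarrow> 'c::finite"
  assumes q: "CARD('c) \<ge> 2"
    and "finite S" "finite W" "card S + j = k" "card W \<ge> CARD('c) ^ (k * j)"
    and "\<And>u w. \<lbrakk>u \<in> S; w \<in> W\<rbrakk> \<Longrightarrow> u < w"
    and "\<And>u v w w'. \<lbrakk>u \<in> S; v \<in> S; w \<in> S \<union> W; w' \<in> S \<union> W; u < v; v < w; v < w'\<rbrakk>
      \<Longrightarrow> c u v w = c u v w'"
  shows "\<exists>S'\<subseteq>S \<union> W. card S' = k \<and> (\<forall>u\<in>S'. \<forall>v\<in>S'. \<forall>w\<in>S'. \<forall>w'\<in>S'.
    u < v \<longrightarrow> v < w \<longrightarrow> v < w' \<longrightarrow> c u v w = c u v w')"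
  using assms(2-)
proof (induction j arbitrary: S W)
  case 0
  then show ?case by (intro exI[of _ S]) auto
next
  case (Suc j)
  let ?q = "CARD('c)"
  define x where "x = Min W"
  have "0 < ?q ^ (k * Suc j)" using q by simp
  then have "W \<noteq> {}" using Suc.prems(4) by auto
  then have x: "x \<in> W" "\<And>w. w \<in> W - {x} \<Longrightarrow> x < w"
    using Suc.prems(2) by (auto simp: x_def less_le)
  obtain W' where W': "W' \<subseteq> W - {x}" "card (W - {x}) \<le> card W' * ?q ^ card S"
    "\<And>u w w'. \<lbrakk>u \<in> S; w \<in> W'; w' \<in> W'\<rbrakk> \<Longrightarrow> c u x w = c u x w'"
    using large_common_class[of S "W - {x}" "\<lambda>u. c u x"] Suc.prems(1,2)
    by (metis finite_Diff)
  have fin: "finite W'" using W'(1) Suc.prems(2) finite_subset by blast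
  \<comment> \<open>If \<open>W'\<close> were smaller, the loss of the one element \<open>x\<close>
    would have to outweigh a whole factor: the estimates would leave \<open>?q ^ k \<le> 1\<close>,
    impossible for \<open>?q \<ge> 2\<close> and \<open>k \<ge> 1\<close>.\<close>
  have "?q ^ (k * j) \<le> card W'"
  proof (rule ccontr)
    assume "\<not> ?thesis"
    then have "Suc (card W') * ?q ^ k \<le> ?q ^ (k * j) * ?q ^ k" by (intro mult_right_mono) auto
    also have "\<dots> = ?q ^ (k * Suc j)" by (simp add: power_add)
    also have "\<dots> \<le> Suc (card (W - {x}))"
      using Suc.prems(4) card_Suc_Diff1[OF Suc.prems(2) x(1)] by simp
    also have "\<dots> \<le> Suc (card W' * ?q ^ k)"
    proof -
      have "?q ^ card S \<le> ?q ^ k" using q Suc.prems(3) by (intro power_increasing) auto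
      then show ?thesis using W'(2) by (meson Suc_le_mono le_trans mult_le_mono2)
    qed
    finally have "?q ^ k \<le> 1" by simp
    moreover have "?q ^ 1 \<le> ?q ^ k" using q Suc.prems(3) by (intro power_increasing) auto
    ultimately show False using q by simp
  qed
  moreover have "card (insert x S) + j = k"
    using Suc.prems x by (subst card_insert_disjoint) auto
  moreover have "u < w" if "u \<in> insert x S" "w \<in> W'" for u w
    using that Suc.prems(5) x(2) W'(1) by blast
  moreover have "c u v w = c u v w'"
    if *: "u \<in> insert x S" "v \<in> insert x S" "w \<in> insert x S \<union> W'" "w' \<in> insert x S \<union> W'"
      "u < v" "v < w" "v < w'" for u v w w'
  proof -
    \<comment> \<open>Since \<open>x\<close> lies above all of \<open>S\<close>, it cannot be the
      smaller of two selected elements. Hence only triples with middle element \<open>x\<close>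
      impose a new condition, and \<open>W'\<close> was chosen to meet it.\<close>
    have "u \<in> S" using * Suc.prems(5) x(1) by fastforce
    show ?thesis
    proof (cases "v = x")
      case True
      then have "w \<in> W'" "w' \<in> W'" using * Suc.prems(5)[OF _ x(1)] by fastforce+
      then show ?thesis using W'(3) True \<open>u \<in> S\<close> by blast
    next
      case False
      then show ?thesis using * Suc.prems(6)[of u v w w'] \<open>u \<in> S\<close> x(1) W'(1) by blast
    qed
  qed
  ultimately obtain S' where S': "S' \<subseteq> insert x S \<union> W'" "card S' = k" "\<forall>u\<in>S'. \<forall>v\<in>S'. \<forall>w\<in>S'. \<forall>w'\<in>S'.
    u < v \<longrightarrow> v < w \<longrightarrow> v < w' \<longrightarrow> c u v w = c u v w'"
    using Suc.IH[of "insert x S" W'] Suc.prems(1) fin by blast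
  have "S' \<subseteq> S \<union> W" using S'(1) x(1) W'(1) by blast
  then show ?case using S'(2,3) by (intro exI[of _ S'] conjI)
qed

text \<open>In an end-homogeneous set \<open>R\<close> the third element of a triple may be replaced
  by the maximum \<open>z\<close>, which reduces the claim to pairs coloured by
  \<open>c u v z\<close>. The \<open>+ 1\<close> inside the square provides for \<open>z\<close>,
  and the square is \<open>k * j\<close> with \<open>j = k\<close>, selecting all of
  \<open>R\<close> from an empty start.\<close>

lemma ramsey_triples:
  fixes c :: "'a::linorder \<Rightarrow> 'a \<Rightarrow> 'a \<Rightarrow> 'c::finite"
  assumes "finite W" "CARD('c) \<ge> 2"
    and "card W \<ge> CARD('c) ^ ((CARD('c) ^ (CARD('c) * m) + 1)\<^sup>2)"
  obtains S col where "S \<subseteq> W" "card S \<ge> m"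
    "\<And>u v w. \<lbrakk>u \<in> S; v \<in> S; w \<in> S; u < v; v < w\<rbrakk> \<Longrightarrow> c u v w = col"
proof -
  define k where "k = CARD('c) ^ (CARD('c) * m) + 1"
  have "card W \<ge> CARD('c) ^ (k * k)" using assms(3) by (simp add: k_def power2_eq_square)
  then have "\<exists>R\<subseteq>{} \<union> W. card R = k \<and> (\<forall>u\<in>R. \<forall>v\<in>R. \<forall>w\<in>R. \<forall>w'\<in>R.
    u < v \<longrightarrow> v < w \<longrightarrow> v < w' \<longrightarrow> c u v w = c u v w')"
    by (intro end_homogeneous_triples_extend[where j = k]) (use assms in simp_all)
  then obtain R where R: "R \<subseteq> W" "card R = k" "\<forall>u\<in>R. \<forall>v\<in>R. \<forall>w\<in>R. \<forall>w'\<in>R.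
    u < v \<longrightarrow> v < w \<longrightarrow> v < w' \<longrightarrow> c u v w = c u v w'"
    by auto
  define z where "z = Max R"
  have fin: "finite R" using R(1) assms(1) finite_subset by blast
  have "R \<noteq> {}" using R(2) by (auto simp: k_def)
  then have z: "z \<in> R" "\<And>w. w \<in> R - {z} \<Longrightarrow> w < z" using fin by (auto simp: z_def less_le)
  have "card (R - {z}) \<ge> CARD('c) ^ (CARD('c) * m)" using z(1) R(2) fin by (simp add: k_def)
  then obtain S col where S: "S \<subseteq> R - {z}" "card S \<ge> m"
    "\<And>u v. \<lbrakk>u \<in> S; v \<in> S; u < v\<rbrakk> \<Longrightarrow> c u v z = col"
    using ramsey_pairs[of "R - {z}" m "\<lambda>u v. c u v z"] fin assms(2) by (metis finite_Diff)
  show thesis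
  proof (rule that[of S col])
    fix u v w assume *: "u \<in> S" "v \<in> S" "w \<in> S" "u < v" "v < w"
    then have "c u v w = c u v z" using R(3) S(1) z by blast
    then show "c u v w = col" using S(3) * by simp
  qed (use S R(1) in auto)
qed


section \<open>Orientation and crossing\<close>

text \<open>Twice the signed area of the triangle \<open>a b c\<close>, positive if it runs
  counterclockwise.\<close>

definition orient :: "point \<Rightarrow> point \<Rightarrow> point \<Rightarrow> real" where
  "orient a b c = (b$1 - a$1) * (c$2 - a$2) - (b$2 - a$2) * (c$1 - a$1)"

lemma orient_rotate: "orient a b c = orient b c a"
  by (simp add: orient_def algebra_simps)

lemma orient_swap: "orient a c b = - orient a b c"
  by (simp add: orient_def algebra_simps)

lemma orient_same [simp]: "orient a b a = 0" "orient a b b = 0" "orient a a b = 0"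
  by (simp_all add: orient_def)

lemma orient_eq_0_imp_collinear:
  assumes "orient a b c = 0"
  shows "collinear {a, b, c}"
proof (cases "b = a")
  case False
  have eq: "(b$1 - a$1) * (c$2 - a$2) = (b$2 - a$2) * (c$1 - a$1)"
    using assms by (simp add: orient_def)
  have "\<exists>t. c - a = t *\<^sub>R (b - a)"
  proof (cases "b$1 = a$1")
    case True
    then have "b$2 \<noteq> a$2" using False by (auto simp: vec_eq_iff forall_2)
    then show ?thesis using eq True
      by (intro exI[of _ "(c$2 - a$2) / (b$2 - a$2)"]) (auto simp: vec_eq_iff forall_2)
  next
    case False
    then have "c$2 - a$2 = (c$1 - a$1) / (b$1 - a$1) * (b$2 - a$2)"
      using eq by (simp add: nonzero_eq_divide_eq mult.commute)
    then show ?thesis using False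
      by (intro exI[of _ "(c$1 - a$1) / (b$1 - a$1)"]) (simp add: vec_eq_iff forall_2)
  qed
  then have "collinear {0, b - a, c - a}" by (auto simp: collinear_lemma)
  then have "collinear {b, a, c}"
    by (subst collinear_3) auto
  then show ?thesis by (simp add: insert_commute)
qed auto

text \<open>\<open>orient\<close> is affine in its last argument.\<close>

lemma orient_open_segment:
  assumes "z \<in> open_segment a b"
  obtains t where "0 < t" "t < 1" "\<And>c d. orient c d z = (1 - t) * orient c d a + t * orient c d b"
proof -
  obtain t where t: "0 < t" "t < 1" "z = (1 - t) *\<^sub>R a + t *\<^sub>R b"
    using assms by (auto simp: in_segment)
  show thesis
    by (rule that[OF t(1,2)]) (simp add: t(3) orient_def algebra_simps)
qed

text \<open>The line through \<open>c\<close> and \<open>d\<close> separates. A point inside the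
  segment from \<open>a\<close> to \<open>b\<close> is a proper convex combination of two points on
  one closed side, not both on the line, so it lies strictly on that side. The sign of
  \<open>s\<close> selects the side.\<close>

lemma open_segments_disjoint_if_one_side:
  assumes "s * orient c d a \<ge> 0" "s * orient c d b \<ge> 0"
    and "s * orient c d a > 0 \<or> s * orient c d b > 0"
  shows "open_segment a b \<inter> open_segment c d = {}"
proof (rule ccontr)
  assume "\<not> ?thesis"
  then obtain z where z: "z \<in> open_segment a b" "z \<in> open_segment c d" by blast
  obtain t where t: "0 < t" "t < 1" "orient c d z = (1 - t) * orient c d a + t * orient c d b"
    using orient_open_segment[OF z(1)] by metis
  have "orient c d z = 0" using orient_open_segment[OF z(2)] by (metis add.right_neutral mult_zero_right orient_same(1,2))
  then have "(1 - t) * (s * orient c d a) + t * (s * orient c d b) = 0"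
    using t(3) by algebra
  moreover have "(1 - t) * (s * orient c d a) + t * (s * orient c d b) > 0"
    using assms t(1,2) by (meson add_nonneg_pos add_pos_nonneg diff_gt_0_iff_gt less_imp_le mult_nonneg_nonneg mult_pos_pos)
  ultimately show False by simp
qed

text \<open>Consistent orientation makes the points follow a convex curve in the order of their
  indices. Non-interleaving intervals are disjoint or nested, and then the line through one edge has
  the other edge on one side. For nested intervals this is the line of the outer edge, and the sign
  changes.\<close>

lemma open_segments_disjoint_if_not_interleaving:
  fixes P :: "'a::linorder \<Rightarrow> point"
  assumes pos: "\<And>u v w. \<lbrakk>u \<in> S; v \<in> S; w \<in> S; u < v; v < w\<rbrakk> \<Longrightarrow> s * orient (P u) (P v) (P w) > 0"
    and S: "a \<in> S" "b \<in> S" "c \<in> S" "d \<in> S" and less: "a < b" "c < d" and neq: "(a, b) \<noteq> (c, d)"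
    and "\<not> (a < c \<and> c < b \<and> b < d)" "\<not> (c < a \<and> a < d \<and> d < b)"
  shows "open_segment (P a) (P b) \<inter> open_segment (P c) (P d) = {}"
proof -
  \<comment> \<open>Orientation vanishes on repeated points, so the weak inequality survives equal
    indices. This covers edges that share an endpoint.\<close>
  have nonneg: "s * orient (P u) (P v) (P w) \<ge> 0"
    if "u \<in> S" "v \<in> S" "w \<in> S" "u \<le> v" "v \<le> w" for u v w
  proof (cases "u = v \<or> v = w")
    case False
    then have "u < v" "v < w" using that by auto
    then show ?thesis using pos that(1-3) by (simp add: less_imp_le)
  qed auto
  have disjoint: "open_segment (P a) (P b) \<inter> open_segment (P c) (P d) = {}"
    if "a \<in> S" "b \<in> S" "c \<in> S" "d \<in> S" "a < b" "b \<le> c" "c < d" for a b c d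
  proof (rule open_segments_disjoint_if_one_side[where s = s])
    show "s * orient (P c) (P d) (P a) \<ge> 0" "s * orient (P c) (P d) (P b) \<ge> 0"
      using nonneg[of a c d] nonneg[of b c d] that by (simp_all add: orient_rotate[of "P a"] orient_rotate[of "P b"])
    have "s * orient (P c) (P d) (P a) > 0"
      using pos[of a c d] that by (simp add: orient_rotate[of "P a"])
    then show "s * orient (P c) (P d) (P a) > 0 \<or> s * orient (P c) (P d) (P b) > 0" ..
  qed
  have nested: "open_segment (P b) (P c) \<inter> open_segment (P a) (P d) = {}"
    if "a \<in> S" "b \<in> S" "c \<in> S" "d \<in> S" "a \<le> b" "b < c" "c \<le> d" "(a, d) \<noteq> (b, c)" for a b c d
  proof (rule open_segments_disjoint_if_one_side[where s = "- s"])
    show "- s * orient (P a) (P d) (P b) \<ge> 0" "- s * orient (P a) (P d) (P c) \<ge> 0"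
      using nonneg[of a b d] nonneg[of a c d] that by (simp_all add: orient_swap[of _ "P d"])
    show "- s * orient (P a) (P d) (P b) > 0 \<or> - s * orient (P a) (P d) (P c) > 0"
    proof (cases "a < b")
      case True
      then show ?thesis using pos[of a b d] that by (simp add: orient_swap[of _ "P d"])
    next
      case False
      then show ?thesis using pos[of a c d] that by (simp add: orient_swap[of _ "P d"])
    qed
  qed
  consider "b \<le> c" | "d \<le> a" | "c \<le> a" "b \<le> d" | "a \<le> c" "d \<le> b"
    using assms by force
  then show ?thesis
  proof cases
    case 1
    then show ?thesis using disjoint S less by blast
  next
    case 2
    then show ?thesis using disjoint[of c d a b] S less by blast
  next
    case 3
    then show ?thesis using nested[of c a b d] S less neq by auto
  next
    case 4
    then show ?thesis using nested[of a c d b] S less neq by auto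
  qed
qed


section \<open>The complete binary tree of bit strings\<close>

text \<open>Paths must be \<open>distinct\<close>, so a path that already visits \<open>w\<close> is
  cut off there instead of being prolonged.\<close>

lemma graph_path_extend:
  assumes "graph_path G p" "{last p, w} \<in> edges G" "w \<in> verts G"
  shows "\<exists>p'. graph_path G p' \<and> hd p' = hd p \<and> last p' = w"
proof (cases "w \<in> set p")
  case True
  then obtain ys zs where p: "p = ys @ w # zs" by (auto simp: in_set_conv_decomp)
  have "graph_path G (ys @ [w])"
    using assms(1) unfolding p graph_path_def by (auto simp: successively_append_iff)
  moreover have "hd (ys @ [w]) = hd p" unfolding p by (cases ys) auto
  ultimately show ?thesis by (intro exI[of _ "ys @ [w]"]) simp
next
  case False
  then have "graph_path G (p @ [w])"
    using assms unfolding graph_path_def by (auto simp: successively_append_iff)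
  moreover have "hd (p @ [w]) = hd p" using assms(1) by (simp add: graph_path_def)
  ultimately show ?thesis by (intro exI[of _ "p @ [w]"]) simp
qed

text \<open>The edge relation of the infinite binary tree, so that paths and cycles can be studied
  on strings before a depth and a placement are fixed.\<close>

definition adjacent :: "bool list \<Rightarrow> bool list \<Rightarrow> bool" where
  "adjacent xs ys \<longleftrightarrow> (\<exists>b. ys = xs @ [b] \<or> xs = ys @ [b])"

lemma adjacent_sym: "adjacent xs ys \<Longrightarrow> adjacent ys xs"
  by (auto simp: adjacent_def)

lemma adjacent_longer_unique:
  assumes "adjacent xs ys" "length ys \<le> length xs"
  shows "ys = butlast xs"
  using assms by (auto simp: adjacent_def)

lemma successively_adjacent_prefixes: "successively adjacent (prefixes xs)"
  by (induction xs rule: rev_induct) (auto simp: successively_append_iff adjacent_def)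

text \<open>A path from the root cannot turn back: it has visited every prefix of its current
  string, so the parent is already used and each further step appends a bit.\<close>

lemma path_from_Nil_eq_prefixes:
  assumes "q \<noteq> []" "distinct q" "hd q = []" "successively adjacent q"
  shows "q = prefixes (last q)"
  using assms
proof (induction q rule: rev_nonempty_induct)
  case (snoc x q)
  then have q: "q = prefixes (last q)" and adj: "adjacent (last q) x" and "x \<notin> set q"
    by (auto simp: successively_append_iff)
  from adj obtain b where "x = last q @ [b] \<or> last q = x @ [b]"
    by (auto simp: adjacent_def)
  then show ?case
  proof
    assume "x = last q @ [b]"
    then show ?thesis using q by simp
  next
    assume "last q = x @ [b]"
    then have "x \<in> set (prefixes (last q))" by simp
    then show ?thesis using q \<open>x \<notin> set q\<close> by simp
  qed
qed simp

lemma no_adjacent_cycle: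
  assumes "distinct q" "length q \<ge> 3" "successively adjacent q"
  shows "\<not> adjacent (last q) (hd q)"
proof
  \<comment> \<open>A longest string on the cycle would have its only shorter neighbour on both sides.\<close>
  assume closed: "adjacent (last q) (hd q)"
  let ?n = "length q"
  have adj: "adjacent (q ! i) (q ! (Suc i mod ?n))" if "i < ?n" for i
  proof (cases "Suc i < ?n")
    case True
    then show ?thesis using assms(3) successively_conv_nth by auto
  next
    case False
    then have "Suc i = ?n" using that by simp
    moreover from this have "i = ?n - 1" by simp
    moreover have "q \<noteq> []" using assms(2) by auto
    ultimately show ?thesis using closed by (simp add: last_conv_nth hd_conv_nth)
  qed
  obtain i where i: "i < ?n" "\<And>j. j < ?n \<Longrightarrow> length (q ! j) \<le> length (q ! i)"
  proof -
    have "q \<noteq> []" using assms(2) by auto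
    then have "Max ((\<lambda>j. length (q ! j)) ` {..<?n}) \<in> (\<lambda>j. length (q ! j)) ` {..<?n}"
      by (intro Max_in) auto
    then obtain i where "i < ?n" "length (q ! i) = Max ((\<lambda>j. length (q ! j)) ` {..<?n})" by auto
    then show thesis using that[of i] by simp
  qed
  define j where "j = (if i = 0 then ?n - 1 else i - 1)"
  have j: "j < ?n" "Suc j mod ?n = i" using i(1) assms(2) by (auto simp: j_def)
  have k: "Suc i mod ?n < ?n" by (rule mod_less_divisor[OF le_less_trans[OF le0 i(1)]])
  have "q ! (Suc i mod ?n) = butlast (q ! i)" using adj[OF i(1)] i(2)[OF k] adjacent_longer_unique by blast
  moreover have "q ! j = butlast (q ! i)"
    using adj[OF j(1)] i(2)[OF j(1)] adjacent_longer_unique adjacent_sym unfolding j(2) by blast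
  \<comment> \<open>The cyclic predecessor and successor of a position coincide only on cycles of
    length at most two.\<close>
  ultimately have "j = Suc i mod ?n" using nth_eq_iff_index_eq[OF assms(1) j(1) k] by simp
  then show False using i(1) assms(2) by (cases "Suc i = ?n") (auto simp: j_def split: if_splits)
qed

lemma less_append_Cons: "(xs :: 'a::linorder list) < xs @ y # ys"
  by (induction xs) auto

text \<open>The lexicographic order is the preorder traversal of the tree.\<close>

lemma lex_not_interleaving:
  fixes xs ys :: "bool list"
  assumes "xs < ys" "ys < xs @ [b]"
  shows "\<not> xs @ [b] < ys @ [c]"
  using assms
\<comment> \<open>A string strictly between \<open>xs\<close> and its child \<open>xs @ [b]\<close>
  exists only for \<open>b = True\<close> and then extends \<open>xs @ [False]\<close>. So does its
  own child, which therefore stays below \<open>xs @ [True]\<close>.\<close>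
proof (induction xs arbitrary: ys)
  case Nil
  then show ?case by (cases ys) auto
next
  case (Cons x xs)
  then show ?case by (cases ys) auto
qed

section \<open>The tree placed on arbitrary distinct vertices\<close>

definition binary_tree :: "(bool list \<Rightarrow> 'v) \<Rightarrow> nat \<Rightarrow> 'v graph" where
  "binary_tree P d = (P ` {xs. length xs \<le> d}, {{P xs, P (xs @ [b])} |xs b. length xs < d})"

lemma finite_bool_lists: "finite {xs :: bool list. length xs \<le> d}"
  using finite_lists_length_le[of "UNIV :: bool set" d] by simp

lemma card_bool_lists: "card {xs :: bool list. length xs \<le> d} = 2 ^ Suc d - 1"
  using card_lists_length_le[of "UNIV :: bool set" d] sum_power2[of "Suc d"]
  by (simp add: atLeast0LessThan lessThan_Suc_atMost)

locale embedded_binary_tree =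
  fixes P :: "bool list \<Rightarrow> 'v" and d :: nat
  assumes inj: "inj_on P {xs. length xs \<le> d}"
begin

lemma P_eq_iff: "length xs \<le> d \<Longrightarrow> length ys \<le> d \<Longrightarrow> P xs = P ys \<longleftrightarrow> xs = ys"
  using inj by (auto simp: inj_on_def)

lemma edge_iff:
  assumes "length xs \<le> d" "length ys \<le> d"
  shows "{P xs, P ys} \<in> edges (binary_tree P d) \<longleftrightarrow> adjacent xs ys"
proof
  assume "{P xs, P ys} \<in> edges (binary_tree P d)"
  then obtain zs b where *: "length zs < d" "{P xs, P ys} = {P zs, P (zs @ [b])}"
    by (auto simp: binary_tree_def)
  then have "xs = zs \<and> ys = zs @ [b] \<or> xs = zs @ [b] \<and> ys = zs"
    using assms by (auto simp: doubleton_eq_iff P_eq_iff)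
  then show "adjacent xs ys" by (auto simp: adjacent_def)
next
  assume "adjacent xs ys"
  then obtain b where "ys = xs @ [b] \<or> xs = ys @ [b]" by (auto simp: adjacent_def)
  then show "{P xs, P ys} \<in> edges (binary_tree P d)"
  proof
    assume "ys = xs @ [b]"
    then show ?thesis using assms by (auto simp: binary_tree_def)
  next
    assume "xs = ys @ [b]"
    then show ?thesis using assms by (auto simp: binary_tree_def insert_commute)
  qed
qed

lemma graph_path_iff:
  "graph_path (binary_tree P d) p \<longleftrightarrow> (\<exists>q. p = map P q \<and> q \<noteq> [] \<and> distinct q \<and>
     set q \<subseteq> {xs. length xs \<le> d} \<and> successively adjacent q)"
proof
  assume p: "graph_path (binary_tree P d) p"
  let ?V = "{xs. length xs \<le> d}"
  define q where "q = map (inv_into ?V P) p"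
  have sub: "set p \<subseteq> P ` ?V" using p by (simp add: graph_path_def binary_tree_def)
  have pq: "p = map P q" unfolding q_def
    using sub by (auto simp: o_def f_inv_into_f intro!: map_idI[symmetric])
  have qV: "set q \<subseteq> ?V" using sub inv_into_into[of _ P ?V] unfolding q_def by fastforce
  have "successively (\<lambda>u v. {u, v} \<in> edges (binary_tree P d)) p"
    using p by (simp add: graph_path_def)
  then have "successively (\<lambda>xs ys. {P xs, P ys} \<in> edges (binary_tree P d)) q"
    by (simp add: pq successively_map)
  then have "successively adjacent q"
    by (rule successively_mono) (use qV edge_iff in blast)
  moreover have "distinct q" "q \<noteq> []" using p by (auto simp: graph_path_def pq distinct_map)
  ultimately show "\<exists>q. p = map P q \<and> q \<noteq> [] \<and> distinct q \<and>
     set q \<subseteq> {xs. length xs \<le> d} \<and> successively adjacent q" using pq qV by blast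
next
  assume "\<exists>q. p = map P q \<and> q \<noteq> [] \<and> distinct q \<and>
     set q \<subseteq> {xs. length xs \<le> d} \<and> successively adjacent q"
  then obtain q where q: "p = map P q" "q \<noteq> []" "distinct q"
    "set q \<subseteq> {xs. length xs \<le> d}" "successively adjacent q" by blast
  have "successively (\<lambda>xs ys. {P xs, P ys} \<in> edges (binary_tree P d)) q"
    by (rule successively_mono[OF q(5)]) (use q(4) edge_iff in blast)
  then show "graph_path (binary_tree P d) p"
    using q inj by (auto simp: graph_path_def distinct_map successively_map
      binary_tree_def intro: inj_on_subset)
qed

text \<open>The paths from the root are the lists of prefixes. Children, leaves and root-leaf paths,
  all defined by such paths, thereby become computations with strings.\<close>

lemma path_from_root_iff:
  "path_from (binary_tree P d) (P []) p \<longleftrightarrow> (\<exists>xs. length xs \<le> d \<and> p = map P (prefixes xs))"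
proof
  assume "path_from (binary_tree P d) (P []) p"
  then obtain q where q: "p = map P q" "q \<noteq> []" "distinct q"
    "set q \<subseteq> {xs. length xs \<le> d}" "successively adjacent q" and "hd p = P []"
    by (auto simp: path_from_def graph_path_iff)
  then have "P (hd q) = P []" by (simp add: hd_map)
  moreover have "hd q \<in> set q" "last q \<in> set q" using q(2) by simp_all
  ultimately have "hd q = []" "length (last q) \<le> d" using q(4) P_eq_iff by auto
  then show "\<exists>xs. length xs \<le> d \<and> p = map P (prefixes xs)"
    using path_from_Nil_eq_prefixes[OF q(2,3) _ q(5)] q(1) by metis
next
  assume "\<exists>xs. length xs \<le> d \<and> p = map P (prefixes xs)"
  then obtain xs where xs: "length xs \<le> d" "p = map P (prefixes xs)" by blast
  have "graph_path (binary_tree P d) p"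
    unfolding graph_path_iff using xs
    by (intro exI[of _ "prefixes xs"])
      (fastforce simp: successively_adjacent_prefixes distinct_prefixes dest: prefix_length_le)
  then show "path_from (binary_tree P d) (P []) p"
    using xs(2) by (simp add: path_from_def hd_map)
qed

lemma children_eq:
  assumes "length xs \<le> d"
  shows "children (binary_tree P d) (P []) (P xs) = {P (xs @ [b]) |b. length xs < d}"
proof (intro equalityI subsetI)
  fix w assume "w \<in> children (binary_tree P d) (P []) (P xs)"
  then have "\<exists>p ys. length ys \<le> d \<and> p @ [P xs, w] = map P (prefixes ys)"
    unfolding children_def path_from_root_iff by simp
  then obtain p ys where ys: "length ys \<le> d" "map P (prefixes ys) = p @ [P xs, w]" by metis
  show "w \<in> {P (xs @ [b]) |b. length xs < d}"
  proof (cases ys rule: rev_cases)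
    case (snoc zs b)
    then have "w = P (zs @ [b])" "map P (prefixes zs) = p @ [P xs]" using ys(2) by auto
    moreover from this(2) have "P (last (prefixes zs)) = P xs"
      by (metis last_map last_snoc prefixes_not_Nil)
    ultimately show ?thesis using snoc ys(1) assms by (auto simp: P_eq_iff)
  qed (use ys in auto)
next
  fix w assume "w \<in> {P (xs @ [b]) |b. length xs < d}"
  then obtain b where b: "w = P (xs @ [b])" "length xs < d" by blast
  have "prefixes xs = butlast (prefixes xs) @ [xs]"
    using append_butlast_last_id[of "prefixes xs"] by simp
  then have "map P (prefixes xs) = map P (butlast (prefixes xs)) @ [P xs]"
    by (metis list.simps(8,9) map_append)
  then have "map P (prefixes (xs @ [b])) = map P (butlast (prefixes xs)) @ [P xs, w]"
    using b(1) by simp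
  moreover have "length (xs @ [b]) \<le> d" using b(2) by simp
  ultimately have "\<exists>p ys. length ys \<le> d \<and> p @ [P xs, w] = map P (prefixes ys)" by metis
  then show "w \<in> children (binary_tree P d) (P []) (P xs)"
    unfolding children_def path_from_root_iff by simp
qed

lemma is_leaf_iff:
  assumes "length xs \<le> d"
  shows "is_leaf (binary_tree P d) (P []) (P xs) \<longleftrightarrow> length xs = d"
  using assms by (auto simp: is_leaf_def children_eq) (auto simp: binary_tree_def)

lemma root_leaf_path_iff:
  "root_leaf_path (binary_tree P d) (P []) p \<longleftrightarrow> (\<exists>xs. length xs = d \<and> p = map P (prefixes xs))"
proof -
  have "is_leaf (binary_tree P d) (P []) (last (map P (prefixes xs))) \<longleftrightarrow> length xs = d"
    if "length xs \<le> d" for xs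
    using is_leaf_iff[OF that] by (simp add: last_map)
  then show ?thesis unfolding root_leaf_path_def path_from_root_iff by (metis order_refl)
qed

lemma simple: "simple_graph (binary_tree P d)"
proof -
  have "card {P xs, P (xs @ [b])} = 2" if "length xs < d" for xs b
    using that by (simp add: card_2_iff' P_eq_iff)
  then show ?thesis by (auto simp: simple_graph_def binary_tree_def)
qed

text \<open>Any two vertices are joined through the root, up from one and down to the other.
  \<open>graph_path_extend\<close> removes the part walked in both directions.\<close>

lemma connected: "graph_connected (binary_tree P d)"
proof -
  let ?T = "binary_tree P d"
  define reach where "reach u v \<longleftrightarrow> (\<exists>p. graph_path ?T p \<and> hd p = u \<and> last p = v)" for u v
  have step: "reach u (P ys)" if "reach u (P xs)" "adjacent xs ys" "length xs \<le> d" "length ys \<le> d" for u xs ys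
  proof -
    have "P ys \<in> verts ?T" using that by (simp add: binary_tree_def)
    then show ?thesis
      using that graph_path_extend edge_iff[OF that(3,4)] unfolding reach_def by metis
  qed
  have refl: "reach u u" if "u \<in> verts ?T" for u
    using that unfolding reach_def by (intro exI[of _ "[u]"]) (simp add: graph_path_def)
  have up: "reach u (P [])" if "reach u (P xs)" "length xs \<le> d" for u xs
    using that
  proof (induction xs rule: rev_induct)
    case (snoc x xs)
    then show ?case using step[of u "xs @ [x]" xs] by (auto simp: adjacent_def)
  qed
  have down: "reach u (P xs)" if "reach u (P [])" "length xs \<le> d" for u xs
    using that
  proof (induction xs rule: rev_induct)
    case (snoc x xs)
    then show ?case using step[of u xs "xs @ [x]"] by (auto simp: adjacent_def)
  qed
  have "reach u v" if uv: "u \<in> verts ?T" "v \<in> verts ?T" for u v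
  proof -
    obtain xs ys where *: "u = P xs" "length xs \<le> d" "v = P ys" "length ys \<le> d"
      using uv unfolding binary_tree_def by auto
    then have "reach u (P [])" using up refl uv(1) by blast
    then show ?thesis using down * by blast
  qed
  moreover have "P [] \<in> verts ?T" by (simp add: binary_tree_def)
  ultimately show ?thesis unfolding graph_connected_def reach_def by blast
qed

lemma acyclic: "graph_acyclic (binary_tree P d)"
  unfolding graph_acyclic_def
proof
  assume "\<exists>p. graph_path (binary_tree P d) p \<and> length p \<ge> 3 \<and>
    {last p, hd p} \<in> edges (binary_tree P d)"
  then obtain q where q: "q \<noteq> []" "distinct q" "set q \<subseteq> {xs. length xs \<le> d}"
    "successively adjacent q" "length q \<ge> 3"
    "{last (map P q), hd (map P q)} \<in> edges (binary_tree P d)"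
    by (auto simp: graph_path_iff)
  have "hd q \<in> set q" "last q \<in> set q" using q(1) by simp_all
  then have "length (hd q) \<le> d" "length (last q) \<le> d" using q(3) by blast+
  then have "adjacent (last q) (hd q)"
    using q(1,6) edge_iff[of "last q" "hd q"] by (simp add: last_map hd_map)
  then show False using no_adjacent_cycle q by blast
qed

lemma complete: "complete_binary_tree (binary_tree P d) (P [])"
proof -
  have "is_tree (binary_tree P d)"
    using simple connected acyclic finite_bool_lists
    by (simp add: is_tree_def binary_tree_def)
  moreover have "P [] \<in> verts (binary_tree P d)" by (simp add: binary_tree_def)
  moreover have "card (children (binary_tree P d) (P []) v) = 2"
    if v: "v \<in> verts (binary_tree P d)" "\<not> is_leaf (binary_tree P d) (P []) v" for v
  proof -
    obtain xs where xs: "v = P xs" "length xs \<le> d" using v(1) by (auto simp: binary_tree_def)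
    then have "length xs < d" using v(2) is_leaf_iff by fastforce
    then have "children (binary_tree P d) (P []) v = {P (xs @ [False]), P (xs @ [True])}"
      "P (xs @ [False]) \<noteq> P (xs @ [True])"
      using xs by (auto simp: children_eq P_eq_iff)
    then show ?thesis by simp
  qed
  moreover have "\<exists>d'. \<forall>p. root_leaf_path (binary_tree P d) (P []) p \<longrightarrow> length p = Suc d'"
    by (intro exI[of _ d]) (auto simp: root_leaf_path_iff)
  ultimately show ?thesis unfolding complete_binary_tree_def by blast
qed

lemma card_verts: "card (verts (binary_tree P d)) = 2 ^ Suc d - 1"
  using inj by (simp add: binary_tree_def card_image card_bool_lists)

end

text \<open>Used to number the bit strings in preorder by elements of the homogeneous set. The map
  sends \<open>x\<close> to the element of \<open>S\<close> whose rank is that of \<open>x\<close>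
  in \<open>V\<close>.\<close>

lemma strict_mono_embedding:
  fixes V :: "'a::linorder set" and S :: "'b::wellorder set"
  assumes "finite V" "finite S" "card V \<le> card S"
  obtains f where "strict_mono_on V f" "f ` V \<subseteq> S"
proof -
  obtain h where h: "bij_betw h {..<card S} S" "strict_mono_on {..<card S} h"
    using ex_bij_betw_strict_mono_card[OF assms(2)] .
  define rk where "rk x = card {y \<in> V. y < x}" for x
  have rk: "rk x < card S" if "x \<in> V" for x
  proof -
    have "rk x < card V" unfolding rk_def by (rule psubset_card_mono) (use assms that in auto)
    then show ?thesis using assms(3) by simp
  qed
  have rk_less: "rk x < rk y" if "x \<in> V" "y \<in> V" "x < y" for x y
    unfolding rk_def by (rule psubset_card_mono) (use assms that in auto)
  show thesis
  proof (rule that[of "h \<circ> rk"])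
    show "strict_mono_on V (h \<circ> rk)"
      using h(2) rk rk_less by (auto simp: strict_mono_on_def)
    show "(h \<circ> rk) ` V \<subseteq> S" using h(1) rk by (auto simp: bij_betw_def)
  qed
qed


section \<open>Monotone trees in drawings of complete graphs\<close>

lemma nth_prefixes: "i \<le> length xs \<Longrightarrow> prefixes xs ! i = take i xs"
proof (induction xs arbitrary: i)
  case (Cons x xs)
  then show ?case by (cases i) auto
qed simp

lemma take_less_take_Suc:
  assumes "i < length (xs :: 'a::linorder list)"
  shows "take i xs < take (Suc i) xs"
  using less_append_Cons[of "take i xs" "xs ! i" "[]"] assms
  by (simp add: take_Suc_conv_app_nth)

lemma edges_drawing_complete_graph:
  assumes "straight_line_drawing D (complete_graph n)"
  shows "edges D = {e. e \<subseteq> verts D \<and> card e = 2}"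
proof -
  obtain f where f: "bij_betw f (verts D) {..<n}"
    "{e. e \<subseteq> {..<n} \<and> card e = 2} = (\<lambda>e. f ` e) ` edges D"
    using assms by (auto simp: straight_line_drawing_def graph_isomorphic_def complete_graph_def)
  have simple: "simple_graph D"
    using assms by (simp add: straight_line_drawing_def geometric_graph_def)
  have inj: "inj_on f (verts D)" and im: "f ` verts D = {..<n}" using f(1) by (auto simp: bij_betw_def)
  have "e \<in> edges D" if e: "e \<subseteq> verts D" "card e = 2" for e
  proof -
    have "f ` e \<in> {e. e \<subseteq> {..<n} \<and> card e = 2}"
      using e im card_image[OF inj_on_subset[OF inj e(1)]] by auto
    then obtain e' where "e' \<in> edges D" "f ` e = f ` e'" using f(2) by auto
    then show ?thesis
      using inj_on_image_eq_iff[OF inj e(1), of e'] simple by (auto simp: simple_graph_def)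
  qed
  then show ?thesis using simple by (auto simp: simple_graph_def)
qed

text \<open>The bound on \<open>n\<close> is that of \<open>ramsey_triples\<close> for four colours
  and \<open>2 ^ Suc d - 1\<close> elements, the number of bit strings of length at most
  \<open>d\<close>.\<close>

lemma noncrossing_monotone_binary_tree_exists:
  assumes draw: "straight_line_drawing D (complete_graph n)" and ord: "edge_ordering D r"
    and n: "n \<ge> 4 ^ ((4 ^ (4 * (2 ^ Suc d - 1)) + 1)\<^sup>2)"
  shows "\<exists>T \<rho>. noncrossing_monotone_binary_tree D r T \<rho> \<and> card (verts T) = 2 ^ Suc d - 1"
proof -
  let ?V = "{xs :: bool list. length xs \<le> d}"
  have gp: "general_position (verts D)"
    using draw by (simp add: straight_line_drawing_def geometric_graph_def)
  have edges_D: "edges D = {e. e \<subseteq> verts D \<and> card e = 2}"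
    by (rule edges_drawing_complete_graph[OF draw])
  obtain f where f: "bij_betw f (verts D) {..<n}"
    using draw by (auto simp: straight_line_drawing_def graph_isomorphic_def complete_graph_def)
  define pt where "pt = inv_into (verts D) f"
  have pt: "bij_betw pt {..<n} (verts D)" unfolding pt_def by (rule bij_betw_inv_into[OF f])
  define col where
    "col u v w = (edge_less r {pt u, pt v} {pt v, pt w}, orient (pt u) (pt v) (pt w) > 0)" for u v w
  have card_col: "CARD(bool \<times> bool) = 4"
    by (simp add: card_cartesian_product flip: UNIV_Times_UNIV)
  obtain S k where S: "S \<subseteq> {..<n}" "card S \<ge> 2 ^ Suc d - 1"
    and mono: "\<And>u v w. \<lbrakk>u \<in> S; v \<in> S; w \<in> S; u < v; v < w\<rbrakk> \<Longrightarrow> col u v w = k"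
  proof (rule ramsey_triples[where c = col and m = "2 ^ Suc d - 1" and W = "{..<n}"])
    show "CARD(bool \<times> bool) ^ ((CARD(bool \<times> bool) ^ (CARD(bool \<times> bool) * (2 ^ Suc d - 1)) + 1)\<^sup>2)
      \<le> card {..<n}"
      using n by (simp only: card_col card_lessThan)
    show "2 \<le> CARD(bool \<times> bool)" by (simp only: card_col)
  next
    fix S' k'
    assume "S' \<subseteq> {..<n}" "2 ^ Suc d - 1 \<le> card S'"
      "\<And>u v w. \<lbrakk>u \<in> S'; v \<in> S'; w \<in> S'; u < v; v < w\<rbrakk> \<Longrightarrow> col u v w = k'"
    then show thesis by (rule that)
  qed (rule finite_lessThan)
  have "finite S" using S(1) finite_subset by blast
  then obtain g where g: "strict_mono_on ?V g" "g ` ?V \<subseteq> S"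
    using strict_mono_embedding[of ?V S] S(2) finite_bool_lists card_bool_lists by metis
  define P where "P = pt \<circ> g"
  have inj: "inj_on P ?V"
    unfolding P_def
  proof (rule comp_inj_on)
    show "inj_on g ?V" using g(1) by (rule strict_mono_on_imp_inj_on)
    show "inj_on pt (g ` ?V)" using pt g(2) S(1) by (meson bij_betw_def inj_on_subset order_trans)
  qed
  then interpret embedded_binary_tree P d by unfold_locales
  let ?T = "binary_tree P d"
  have verts_T: "P xs \<in> verts D" if "xs \<in> ?V" for xs
    using that pt g(2) S(1) unfolding P_def by (auto simp: bij_betw_def)
  have edge: "{P xs, P ys} \<in> edges D" if "xs \<in> ?V" "ys \<in> ?V" "xs \<noteq> ys" for xs ys
    using that verts_T P_eq_iff by (simp add: edges_D card_2_iff')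
  have colour: "edge_less r {P xs, P ys} {P ys, P zs} \<longleftrightarrow> fst k"
      "orient (P xs) (P ys) (P zs) > 0 \<longleftrightarrow> snd k"
    if "xs \<in> ?V" "ys \<in> ?V" "zs \<in> ?V" "xs < ys" "ys < zs" for xs ys zs
  proof -
    have "col (g xs) (g ys) (g zs) = k"
    proof (rule mono)
      show "g xs < g ys" "g ys < g zs" using that g(1) by (auto simp: strict_mono_on_def)
    qed (use that g(2) in blast)+
    then show "edge_less r {P xs, P ys} {P ys, P zs} \<longleftrightarrow> fst k"
      "orient (P xs) (P ys) (P zs) > 0 \<longleftrightarrow> snd k"
      by (auto simp: col_def P_def)
  qed
  have "subgraph ?T D"
    using simple verts_T edge unfolding subgraph_def by (auto simp: binary_tree_def)
  moreover have "non_crossing ?T"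
    unfolding non_crossing_def
  proof (intro ballI notI)
    fix e h assume "e \<in> edges ?T" "h \<in> edges ?T" and cross: "edges_cross e h"
    then obtain xs b ys c where e: "e = {P xs, P (xs @ [b])}" "length xs < d"
      and h: "h = {P ys, P (ys @ [c])}" "length ys < d"
      by (auto simp: binary_tree_def)
    have "open_segment (P xs) (P (xs @ [b])) \<inter> open_segment (P ys) (P (ys @ [c])) = {}"
    proof (rule open_segments_disjoint_if_not_interleaving[where S = ?V and s = "if snd k then 1 else - 1"])
      fix us vs ws assume *: "us \<in> ?V" "vs \<in> ?V" "ws \<in> ?V" "us < vs" "vs < ws"
      \<comment> \<open>A false second bit says only that the orientation is at most 0; general
        position excludes 0.\<close>
      have "P us \<noteq> P vs" "P vs \<noteq> P ws" "P us \<noteq> P ws" using * by (auto simp: P_eq_iff)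
      then have "card {P us, P vs, P ws} = 3" by simp
      then have "\<not> collinear {P us, P vs, P ws}"
        using gp verts_T * unfolding general_position_def by (metis empty_subsetI insert_subset)
      then have "orient (P us) (P vs) (P ws) \<noteq> 0" using orient_eq_0_imp_collinear by blast
      then show "(if snd k then 1 else - 1) * orient (P us) (P vs) (P ws) > 0"
        using colour(2)[OF *] by auto
    next
      show "(xs, xs @ [b]) \<noteq> (ys, ys @ [c])" using cross e h by (auto simp: edges_cross_def)
      show "xs < xs @ [b]" "ys < ys @ [c]" by (rule less_append_Cons)+
      show "\<not> (xs < ys \<and> ys < xs @ [b] \<and> xs @ [b] < ys @ [c])"
        "\<not> (ys < xs \<and> xs < ys @ [c] \<and> ys @ [c] < xs @ [b])"
        using lex_not_interleaving by blast+
    qed (use e h in auto)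
    moreover have "open_segment (P xs) (P (xs @ [b])) \<inter> open_segment (P ys) (P (ys @ [c])) \<noteq> {}"
    proof -
      \<comment> \<open>\<open>edges_cross\<close> names the endpoints in an unspecified order, so
        the segments are identified up to reversal.\<close>
      obtain p q p' q' where "e = {p, q}" "h = {p', q'}" "open_segment p q \<inter> open_segment p' q' \<noteq> {}"
        using cross unfolding edges_cross_def by blast
      moreover have "open_segment p q = open_segment (P xs) (P (xs @ [b]))"
        using \<open>e = {p, q}\<close> e(1) by (auto simp: doubleton_eq_iff open_segment_commute)
      moreover have "open_segment p' q' = open_segment (P ys) (P (ys @ [c]))"
        using \<open>h = {p', q'}\<close> h(1) by (auto simp: doubleton_eq_iff open_segment_commute)
      ultimately show ?thesis by simp
    qed
    ultimately show False by simp
  qed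
  moreover have "monotone_tree r ?T (P [])"
  proof -
    \<comment> \<open>Consecutive vertices of a root-leaf path carry successive prefixes of one
      string, which increase in preorder, so the common colour applies to each three of
      them.\<close>
    have path: "\<exists>us vs ws. us \<in> ?V \<and> vs \<in> ?V \<and> ws \<in> ?V \<and> us < vs \<and> vs < ws \<and>
        p ! i = P us \<and> p ! (i + 1) = P vs \<and> p ! (i + 2) = P ws"
      if p: "root_leaf_path ?T (P []) p" "i + 2 < length p" for p i
    proof -
      obtain xs where xs: "length xs = d" "p = map P (prefixes xs)"
        using p(1) unfolding root_leaf_path_iff by blast
      then show ?thesis
        using p(2) take_less_take_Suc[of i xs] take_less_take_Suc[of "Suc i" xs]
        by (intro exI[of _ "take i xs"] exI[of _ "take (i + 1) xs"] exI[of _ "take (i + 2) xs"])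
          (auto simp: nth_prefixes)
    qed
    show ?thesis
    proof (cases "fst k")
      case True
      \<comment> \<open>Edges that grow away from the root form a decreasing tree by the convention
        on the direction of reading.\<close>
      have "decreasing_tree r ?T (P [])"
        unfolding decreasing_tree_def decreasing_path_def
      proof (intro allI impI)
        fix p i assume "root_leaf_path ?T (P []) p" "i + 2 < length p"
        then show "edge_less r {p ! i, p ! (i + 1)} {p ! (i + 1), p ! (i + 2)}"
          using path colour(1) True by metis
      qed
      then show ?thesis by (simp add: monotone_tree_def)
    next
      case False
      \<comment> \<open>The first bit only denies \<open>edge_less\<close>; as the two edges are
        distinct edges of \<open>D\<close>, totality of \<open>r\<close> yields the reverse
        comparison.\<close>
      have rev: "edge_less r {P vs, P ws} {P us, P vs}"
        if "us \<in> ?V" "vs \<in> ?V" "ws \<in> ?V" "us < vs" "vs < ws" for us vs ws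
      proof -
        have "{P us, P vs} \<noteq> {P vs, P ws}"
          using that by (auto simp: doubleton_eq_iff P_eq_iff)
        moreover have "{P us, P vs} \<in> edges D" "{P vs, P ws} \<in> edges D"
          using that by (auto intro!: edge)
        moreover have "total_on (edges D) r"
          using ord by (simp add: edge_ordering_def linear_order_on_def)
        ultimately show ?thesis
          using colour(1)[OF that] False unfolding edge_less_def total_on_def by metis
      qed
      have "increasing_tree r ?T (P [])"
        unfolding increasing_tree_def increasing_path_def
      proof (intro allI impI)
        fix p i assume "root_leaf_path ?T (P []) p" "i + 2 < length p"
        then show "edge_less r {p ! (i + 1), p ! (i + 2)} {p ! i, p ! (i + 1)}"
          using path rev by metis
      qed
      then show ?thesis by (simp add: monotone_tree_def)
    qed
  qed
  ultimately have "noncrossing_monotone_binary_tree D r ?T (P [])"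
    using complete by (simp add: noncrossing_monotone_binary_tree_def)
  then show ?thesis using card_verts by blast
qed

text \<open>\<open>Max\<close> and \<open>Min\<close> can be estimated because their sets are finite
  and nonempty: tree sizes are at most \<open>card (verts D)\<close>, edge-orderings are subsets of
  a finite product, and a well-order supplies one.\<close>

lemma tau_bar_ge:
  assumes "simple_graph D" "finite (verts D)"
    and tree: "\<And>r. edge_ordering D r \<Longrightarrow>
      \<exists>T \<rho>. noncrossing_monotone_binary_tree D r T \<rho> \<and> k \<le> card (verts T)"
  shows "k \<le> tau_bar D"
proof -
  have fin: "finite (edges D)"
    using assms(1,2) by (auto simp: simple_graph_def intro: finite_subset[of _ "Pow (verts D)"])
  have "k \<le> max_tree_size D r" if r: "edge_ordering D r" for r
  proof -
    let ?A = "{card (verts T) |T. \<exists>\<rho>. noncrossing_monotone_binary_tree D r T \<rho>}"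
    have "?A \<subseteq> {..card (verts D)}"
      using assms(2) by (auto simp: noncrossing_monotone_binary_tree_def subgraph_def intro: card_mono)
    then have "finite ?A" by (rule finite_subset) simp
    moreover obtain T \<rho> where T: "noncrossing_monotone_binary_tree D r T \<rho>" "k \<le> card (verts T)"
      using tree[OF r] by blast
    moreover have "card (verts T) \<in> ?A" using T(1) by blast
    ultimately show ?thesis unfolding max_tree_size_def by (meson Max_ge order_trans)
  qed
  moreover have "finite {max_tree_size D r |r. edge_ordering D r}"
  proof -
    have "{r. edge_ordering D r} \<subseteq> Pow (edges D \<times> edges D)"
      by (auto simp: edge_ordering_def linear_order_on_def partial_order_on_def preorder_on_def)
    then have "finite {r. edge_ordering D r}" by (rule finite_subset) (use fin in simp)
    then show ?thesis by simp
  qed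
  moreover have "{max_tree_size D r |r. edge_ordering D r} \<noteq> {}"
  proof -
    obtain r where "well_order_on (edges D) r" using well_order_on by blast
    then have "edge_ordering D r" by (simp add: edge_ordering_def well_order_on_def)
    then show ?thesis by blast
  qed
  ultimately show ?thesis unfolding tau_bar_def by (subst Min_ge_iff) auto
qed

section \<open>Inverting the doubly exponential bound\<close>

definition tree_threshold :: "nat \<Rightarrow> nat" where
  "tree_threshold d = 4 ^ ((4 ^ (4 * (2 ^ Suc d - 1)) + 1)\<^sup>2)"

lemma ln_ln_tree_threshold:
  assumes "n < tree_threshold d" "n \<ge> 4"
  shows "ln (ln (real n)) \<le> 24 * 2 ^ Suc d"
proof -
  define m :: nat where "m = 2 ^ Suc d - 1"
  have m: "real m \<le> 2 ^ Suc d" by (simp add: m_def of_nat_diff)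
  have one: "(1::real) \<le> 2 ^ d" by simp
  \<comment> \<open>The summand 1 is absorbed by a factor 4, which turns the threshold into a pure
    tower ready for two logarithms.\<close>
  have "(4 ^ (4 * m) + 1 :: nat)\<^sup>2 \<le> (4 * 4 ^ (4 * m))\<^sup>2" by (rule power_mono) auto
  also have "\<dots> = 4 ^ (8 * m + 2)" by (simp add: power_mult_distrib power_add flip: power_mult)
  finally have "tree_threshold d \<le> 4 ^ (4 ^ (8 * m + 2))"
    unfolding tree_threshold_def m_def[symmetric] by (rule power_increasing) simp
  then have "n \<le> 4 ^ (4 ^ (8 * m + 2))" using assms(1) by simp
  then have "real n \<le> 4 ^ (4 ^ (8 * m + 2))" by (metis of_nat_le_iff of_nat_numeral of_nat_power)
  then have "ln (real n) \<le> ln (4 ^ (4 ^ (8 * m + 2)))" using assms(2) by (subst ln_le_cancel_iff) auto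
  also have "\<dots> = 4 ^ (8 * m + 2) * ln 4" by (simp add: ln_realpow)
  also have "\<dots> \<le> 4 ^ (8 * m + 2) * 4" using ln_le_minus_one[of 4] by (intro mult_left_mono) auto
  finally have 1: "ln (real n) \<le> 4 ^ (8 * m + 3)" by (simp add: numeral_3_eq_3)
  have "ln (real n) > 0" using assms(2) by simp
  then have "ln (ln (real n)) \<le> ln (4 ^ (8 * m + 3))" using 1 by (subst ln_le_cancel_iff) auto
  also have "\<dots> = (8 * real m + 3) * ln 4" by (simp add: ln_realpow)
  also have "\<dots> \<le> (8 * real m + 3) * 2"
  proof -
    have "ln (4::real) = 2 * ln 2" using ln_realpow[of 2 2] by simp
    also have "\<dots> \<le> 2" using ln_le_minus_one[of 2] by simp
    finally show ?thesis by (intro mult_left_mono) auto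
  qed
  \<comment> \<open>This is \<open>16 * m + 6\<close> with \<open>m \<le> 2 ^ Suc d\<close> and
    \<open>6 \<le> 8 * 2 ^ Suc d\<close>.\<close>
  also have "\<dots> \<le> 24 * 2 ^ Suc d"
    using m one unfolding power_Suc by argo
  finally show ?thesis .
qed

theorem theorem3:
  shows "\<exists>c::real. c > 0 \<and>
    (\<forall>\<^sub>F n in sequentially. \<forall>D :: point graph. convex_drawing D (complete_graph n) \<longrightarrow>
       real (tau_bar D) \<ge> c * ln (ln (real n)) \<and>
       (\<forall>r. edge_ordering D r \<longrightarrow>
          (\<exists>T \<rho>. noncrossing_monotone_binary_tree D r T \<rho> \<and>
                 real (card (verts T)) \<ge> c * ln (ln (real n)))))"
\<comment> \<open>With \<open>d\<close> maximal for \<open>n\<close>, the logarithmic estimate at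
  \<open>Suc d\<close> gives \<open>24 * 2 ^ Suc (Suc d) = 48 * 2 ^ Suc d\<close>, which is at most
  \<open>96 * (2 ^ Suc d - 1)\<close> because \<open>2 ^ Suc d \<ge> 2\<close>.\<close>
proof (intro exI[of _ "1 / 96 :: real"] conjI)
  show "\<forall>\<^sub>F n in sequentially. \<forall>D :: point graph. convex_drawing D (complete_graph n) \<longrightarrow>
       real (tau_bar D) \<ge> 1 / 96 * ln (ln (real n)) \<and>
       (\<forall>r. edge_ordering D r \<longrightarrow>
          (\<exists>T \<rho>. noncrossing_monotone_binary_tree D r T \<rho> \<and>
                 real (card (verts T)) \<ge> 1 / 96 * ln (ln (real n))))"
    \<comment> \<open>From here on depth 0 is admissible, so a greatest admissible depth exists once
      the depths are bounded; \<open>below\<close> bounds them by \<open>n\<close>.\<close>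
    using eventually_ge_at_top[of "tree_threshold 0"]
  proof eventually_elim
    case (elim n)
    have below: "d \<le> tree_threshold d" for d
    proof -
      have "d \<le> 2 ^ Suc d - 1" using less_exp[of "Suc d"] by simp
      also have "\<dots> \<le> 4 * (2 ^ Suc d - 1)" by simp
      also have "\<dots> \<le> 4 ^ (4 * (2 ^ Suc d - 1))" by (rule less_imp_le[OF power_gt_expt]) simp
      also have "\<dots> \<le> (4 ^ (4 * (2 ^ Suc d - 1)) + 1)\<^sup>2"
        by (simp add: power2_eq_square)
      also have "\<dots> \<le> tree_threshold d"
        unfolding tree_threshold_def by (rule less_imp_le[OF power_gt_expt]) simp
      finally show ?thesis .
    qed
    define d where "d = (GREATEST d. tree_threshold d \<le> n)"
    have le: "tree_threshold d \<le> n" unfolding d_def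
      by (rule GreatestI_nat[where P = "\<lambda>d. tree_threshold d \<le> n" and b = n, OF elim])
        (use below le_trans in blast)
    have "\<not> tree_threshold (Suc d) \<le> n"
    proof
      assume "tree_threshold (Suc d) \<le> n"
      then have "Suc d \<le> d" unfolding d_def
        by (rule Greatest_le_nat[where P = "\<lambda>d. tree_threshold d \<le> n" and b = n])
          (use below le_trans in blast)
      then show False by simp
    qed
    moreover have "4 ^ 1 \<le> tree_threshold d" unfolding tree_threshold_def by (rule power_increasing) auto
    ultimately have "ln (ln (real n)) \<le> 24 * 2 ^ Suc (Suc d)"
      using le by (intro ln_ln_tree_threshold) auto
    also have "\<dots> \<le> 96 * real (2 ^ Suc d - 1)"
      by (simp add: of_nat_diff)
    finally have bound: "1 / 96 * ln (ln (real n)) \<le> real (2 ^ Suc d - 1)" by simp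
    show ?case
    proof (intro allI impI)
      fix D :: "point graph" assume "convex_drawing D (complete_graph n)"
      then have draw: "straight_line_drawing D (complete_graph n)" by (simp add: convex_drawing_def)
      have tree: "\<exists>T \<rho>. noncrossing_monotone_binary_tree D r T \<rho> \<and> card (verts T) = 2 ^ Suc d - 1"
        if "edge_ordering D r" for r
        using noncrossing_monotone_binary_tree_exists[OF draw that] le[unfolded tree_threshold_def] .
      have "2 ^ Suc d - 1 \<le> tau_bar D"
        using tau_bar_ge[of D "2 ^ Suc d - 1"] draw tree
        unfolding straight_line_drawing_def geometric_graph_def by (metis order_refl)
      then have "real (2 ^ Suc d - 1) \<le> real (tau_bar D)" by (rule of_nat_mono)
      then show "real (tau_bar D) \<ge> 1 / 96 * ln (ln (real n)) \<and>
       (\<forall>r. edge_ordering D r \<longrightarrow>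
          (\<exists>T \<rho>. noncrossing_monotone_binary_tree D r T \<rho> \<and>
                 real (card (verts T)) \<ge> 1 / 96 * ln (ln (real n))))"
        using bound tree by (metis order_trans)
    qed
  qed
qed simp

end
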